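(* Let $n\ge1$ and let $\mathfrak{G}^{NN}_n$ be the class of graphs with $n$ nodes, positive minimum out-degree and positive minimum in-degree. (a) For $\Gamma\in\mathfrak{G}^{NN}_n$, $m^\Gamma_\land=n$ if and only if $\Gamma$ admits an SDR. (b) For $n\ge3$, $$\max\{m^\Gamma_\land : \Gamma\in\mathfrak{G}^{NN}_n,\ \Gamma\text{ does not admit an SDR}\}=n-\Delta_n,$$ where $\Delta_{2k-1}=\Delta_{2k}=2k-1-2\sqrt{k(k-1)}$ for integers $k\ge1$.
   Context: A graph $\Gamma$ is a finite simple directed graph with node set $\mathcal{V}(\Gamma)$ and out-neighbour sets $\Gamma^+(v)\subseteq\mathcal{V}(\Gamma)$ (loops allowed, multiple arcs not), considered up to isomorphism. $\Gamma$ admits an SDR if there is a bijection $\sigma:\mathcal{V}(\Gamma)\to\mathcal{V}(\Gamma)$ with $\sigma(v)\in\Gamma^+(v)$ for all $v$ (a system of distinct representatives for the family $\{\Gamma^+(v)\}$). The min-sum is $S^\Gamma_\land(\mathbf{x})=\sum_{v} x_v/\min_{w\in\Gamma^+(v)}x_w$ for $\mathbf{x}=(x_v)\in[0,\infty)^{\mathcal{V}(\Gamma)}$, and $m^\Gamma_\land$ is its infimum over admissible vectors: $\mathbf{x}\neq0$ and $\min_{w\in\Gamma^+(v)}x_w\ne0$ whenever $x_v=0$ (terms $a/0$ with $a>0$ count as $+\infty$). *)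

theory Defs
  imports "Graph_Theory.Pair_Digraph" "HOL-Library.Extended_Real"
begin

text \<open>
  Graphs are finite digraphs with loops allowed and no parallel arcs, i.e. elements of
  the locale \<^locale>\<open>pair_fin_digraph\<close>.
\<close>

definition out_nbrs :: "'a pair_pre_digraph \<Rightarrow> 'a \<Rightarrow> 'a set" where
  "out_nbrs G v = {w. v \<rightarrow>\<^bsub>with_proj G\<^esub> w}"

definition graphs_NN :: "nat \<Rightarrow> 'a pair_pre_digraph set" where
  "graphs_NN n = {G. pair_fin_digraph G \<and> card (pverts G) = n \<and>
     (\<forall>v \<in> pverts G. 0 < out_degree (with_proj G) v \<and> 0 < in_degree (with_proj G) v)}"

definition admits_SDR :: "'a pair_pre_digraph \<Rightarrow> bool" where
  "admits_SDR G \<longleftrightarrow>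
     (\<exists>\<sigma>. bij_betw \<sigma> (pverts G) (pverts G) \<and> (\<forall>v \<in> pverts G. \<sigma> v \<in> out_nbrs G v))"

text \<open>
  Vectors indexed by the nodes are functions on the whole node type, of which only the values
  on the node set matter. The minimum over the out-neighbours is meaningful only for graphs
  of positive minimum out-degree.
\<close>

definition min_out :: "'a pair_pre_digraph \<Rightarrow> ('a \<Rightarrow> real) \<Rightarrow> 'a \<Rightarrow> real" where
  "min_out G x v = Min (x ` out_nbrs G v)"

definition admissible :: "'a pair_pre_digraph \<Rightarrow> ('a \<Rightarrow> real) \<Rightarrow> bool" where
  "admissible G x \<longleftrightarrow> (\<forall>v \<in> pverts G. 0 \<le> x v) \<and> (\<exists>v \<in> pverts G. x v \<noteq> 0) \<and>
     (\<forall>v \<in> pverts G. x v = 0 \<longrightarrow> min_out G x v \<noteq> 0)"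

text \<open>
  Division takes place in \<^typ>\<open>ereal\<close>, where a positive number divided by 0 is \<open>\<infinity>\<close>;
  terms 0/0 do not occur for admissible vectors.
\<close>

definition min_sum :: "'a pair_pre_digraph \<Rightarrow> ('a \<Rightarrow> real) \<Rightarrow> ereal" where
  "min_sum G x = (\<Sum>v \<in> pverts G. ereal (x v) / ereal (min_out G x v))"

definition min_sum_inf :: "'a pair_pre_digraph \<Rightarrow> ereal" where
  "min_sum_inf G = Inf {min_sum G x |x. admissible G x}"

lemma "0 < a \<Longrightarrow> ereal a / ereal 0 = \<infinity>"
  by (simp add: divide_ereal_def)

definition Delta :: "nat \<Rightarrow> real" where
  "Delta n = (let k = real ((n + 1) div 2) in 2 * k - 1 - 2 * sqrt (k * (k - 1)))"

lemma Delta_odd_even: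
  assumes "k \<ge> 1"
  shows "Delta (2 * k - 1) = 2 * real k - 1 - 2 * sqrt (real k * (real k - 1))"
    and "Delta (2 * k) = 2 * real k - 1 - 2 * sqrt (real k * (real k - 1))"
  using assms by (simp_all add: Delta_def Let_def)

end

theory Submission
  imports Defs
begin

text \<open>
  Constant vectors give the upper bound \<open>n\<close>. If \<open>\<sigma>\<close> is an SDR, then the min-sum is at least
  \<open>\<Sum>v. x v / x (\<sigma> v)\<close>, a sum of \<open>n\<close> ratios with product 1, so it is at least \<open>n\<close> by AM-GM.
  Without an SDR, Hall's theorem yields a set \<open>A\<close> of nodes whose joint out-neighbourhood \<open>B\<close> is
  smaller than \<open>A\<close>. The vector equal to \<open>t \<ge> 1\<close> on \<open>B\<close> and to 1 elsewhere has min-sum at most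
  \<open>n - (1 - 1/t) q + (t - 1) r\<close>, where \<open>q = card (A - B) > r = card (B - A)\<close> and \<open>q + r \<le> n\<close>.
  The worst case is \<open>q = r + 1 = k\<close> with \<open>k = (n + 1) div 2\<close>, where \<open>t = sqrt (k / (k - 1))\<close> is
  optimal; it is attained by the complete bipartite graph with parts of sizes \<open>k\<close> and \<open>k - 1\<close>,
  arcs in both directions, together with an isolated loop if \<open>n\<close> is even.
\<close>

section \<open>Hall's marriage theorem\<close>

text \<open>Induction on \<open>card I\<close>. If some nonempty proper subfamily \<open>J\<close>
  is tight, its union having exactly \<open>card J\<close> elements, then \<open>J\<close> and
  \<open>I - J\<close> are matched separately. If none is tight, every nonempty proper subfamily has
  an element to spare, so one index can be matched arbitrarily.\<close>

lemma hall_marriage: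
  assumes "finite I" "\<And>i. i \<in> I \<Longrightarrow> finite (A i)"
    and "\<And>J. J \<subseteq> I \<Longrightarrow> card J \<le> card (\<Union>(A ` J))"
  shows "\<exists>f. inj_on f I \<and> (\<forall>i\<in>I. f i \<in> A i)"
  using assms
proof (induction "card I" arbitrary: I A rule: less_induct)
  case (less I A)
  note finI = less.prems(1) and finA = less.prems(2) and hall = less.prems(3)
  show ?case
  proof (cases "I = {}")
    case False
    show ?thesis
    proof (cases "\<exists>J. J \<noteq> {} \<and> J \<subset> I \<and> card (\<Union>(A ` J)) = card J")
      case True
      then obtain J where J: "J \<noteq> {}" "J \<subset> I" "card (\<Union>(A ` J)) = card J" by blast
      define U where "U = \<Union>(A ` J)"
      have finJ: "finite J" using J finI finite_subset by blast
      have "\<exists>f. inj_on f J \<and> (\<forall>i\<in>J. f i \<in> A i)"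
        by (rule less.hyps) (use J finI finA hall in \<open>auto intro: psubset_card_mono finJ\<close>)
      then obtain f where f: "inj_on f J" "\<forall>i\<in>J. f i \<in> A i" by blast
      have "\<exists>g. inj_on g (I - J) \<and> (\<forall>i\<in>I - J. g i \<in> A i - U)"
      proof (rule less.hyps)
        show "card (I - J) < card I" using J finI by (intro psubset_card_mono) auto
        fix K assume K: "K \<subseteq> I - J"
        have finK: "finite K" using K finI finite_subset by blast
        \<comment> \<open>Hall's condition survives the removal of \<open>U\<close>: apply it to
          \<open>K \<union> J\<close> and cancel \<open>card J = card U\<close>.\<close>
        have "card K + card J = card (K \<union> J)"
          using K finK finJ by (subst card_Un_disjoint) auto
        also have "\<dots> \<le> card (\<Union>(A ` (K \<union> J)))" using K J by (intro hall) auto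
        also have "\<Union>(A ` (K \<union> J)) = (\<Union>i\<in>K. A i - U) \<union> U" by (auto simp: U_def)
        also have "card \<dots> \<le> card (\<Union>i\<in>K. A i - U) + card U" by (rule card_Un_le)
        finally show "card K \<le> card (\<Union>i\<in>K. A i - U)" using J by (simp add: U_def)
      qed (use finI finA in auto)
      then obtain g where g: "inj_on g (I - J)" "\<forall>i\<in>I - J. g i \<in> A i - U" by blast
      let ?h = "\<lambda>i. if i \<in> J then f i else g i"
      have "inj_on ?h (J \<union> (I - J))"
        by (rule inj_on_disjoint_Un) (use f g in \<open>auto simp: U_def\<close>)
      moreover have "J \<union> (I - J) = I" using J by auto
      ultimately show ?thesis using f g by (intro exI[of _ ?h]) auto
    next
      case noeq: False
      obtain i where i: "i \<in> I" using False by blast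
      have "card {i} \<le> card (\<Union>(A ` {i}))" using i by (intro hall) auto
      then have "A i \<noteq> {}" by auto
      then obtain y where y: "y \<in> A i" by blast
      have "\<exists>g. inj_on g (I - {i}) \<and> (\<forall>j\<in>I - {i}. g j \<in> A j - {y})"
      proof (rule less.hyps)
        show "card (I - {i}) < card I" using i finI by (intro psubset_card_mono) auto
        fix K assume K: "K \<subseteq> I - {i}"
        show "card K \<le> card (\<Union>j\<in>K. A j - {y})"
        proof (cases "K = {}")
          case False
          \<comment> \<open>\<open>K\<close> misses \<open>i\<close>, so it is a proper subfamily
            and not tight; the strict inequality pays for the loss of \<open>y\<close>.\<close>
          have "card K < card (\<Union>(A ` K))"
            using hall[of K] noeq K i False by (metis Diff_subset Diff_iff insertI1
              le_neq_implies_less order_trans psubsetI subsetD)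
          also have "\<dots> \<le> Suc (card (\<Union>(A ` K) - {y}))"
            by (auto simp: card_Diff_singleton_if)
          also have "\<Union>(A ` K) - {y} = (\<Union>j\<in>K. A j - {y})" by auto
          finally show ?thesis by simp
        qed simp
      qed (use finI finA in auto)
      then obtain g where g: "inj_on g (I - {i})" "\<forall>j\<in>I - {i}. g j \<in> A j - {y}" by blast
      have "inj_on (g(i := y)) I" using g by (auto simp: inj_on_def)
      then show ?thesis using g y by (intro exI[of _ "g(i := y)"]) auto
    qed
  qed simp
qed

section \<open>The graph class in terms of out-neighbour sets\<close>

lemma mem_out_nbrs_iff: "w \<in> out_nbrs G v \<longleftrightarrow> (v, w) \<in> parcs G"
  by (auto simp: out_nbrs_def arcs_ends_def arc_to_ends_def)

lemma graphs_NN_iff: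
  "G \<in> graphs_NN n \<longleftrightarrow> finite (pverts G) \<and> parcs G \<subseteq> pverts G \<times> pverts G \<and> card (pverts G) = n \<and>
     (\<forall>v \<in> pverts G. out_nbrs G v \<noteq> {} \<and> (\<exists>u. v \<in> out_nbrs G u))" (is "_ \<longleftrightarrow> ?R")
proof -
  have fin: "pair_fin_digraph G \<longleftrightarrow> finite (pverts G) \<and> parcs G \<subseteq> pverts G \<times> pverts G"
    by (auto simp: pair_fin_digraph_def pair_fin_digraph_axioms_def pair_wf_digraph_def
        intro: finite_subset)
  \<comment> \<open>Finiteness matters here: an infinite arc set would have \<open>card\<close>
    0.\<close>
  have "0 < out_degree (with_proj G) v \<longleftrightarrow> out_nbrs G v \<noteq> {}" if "finite (parcs G)" for v
  proof -
    have "finite (out_arcs (with_proj G) v)" using that by (auto simp: out_arcs_def)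
    then show ?thesis
      by (auto simp: out_degree_def card_gt_0_iff out_arcs_def mem_out_nbrs_iff set_eq_iff)
  qed
  moreover have "0 < in_degree (with_proj G) v \<longleftrightarrow> (\<exists>u. v \<in> out_nbrs G u)" if "finite (parcs G)" for v
  proof -
    have "finite (in_arcs (with_proj G) v)" using that by (auto simp: in_arcs_def)
    then show ?thesis
      by (auto simp: in_degree_def card_gt_0_iff in_arcs_def mem_out_nbrs_iff set_eq_iff)
  qed
  moreover have "finite (parcs G)" if "pair_fin_digraph G"
    using that pair_fin_digraph.pair_finite_arcs by auto
  ultimately show ?thesis unfolding graphs_NN_def using fin by blast
qed

text \<open>Hall's theorem read backwards: an injective choice of out-neighbours maps the finite
  node set into itself, hence is bijective and an SDR.\<close>

lemma no_SDR_violator: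
  assumes "G \<in> graphs_NN n" "\<not> admits_SDR G"
  obtains A where "A \<subseteq> pverts G" "card (\<Union>(out_nbrs G ` A)) < card A"
proof (rule ccontr)
  assume "\<not> thesis"
  with that have hall: "\<forall>J. J \<subseteq> pverts G \<longrightarrow> card J \<le> card (\<Union>(out_nbrs G ` J))"
    by (meson not_less)
  have fin: "finite (pverts G)" and sub: "\<And>v. out_nbrs G v \<subseteq> pverts G"
    using assms(1) by (auto simp: graphs_NN_iff mem_out_nbrs_iff)
  have "\<exists>f. inj_on f (pverts G) \<and> (\<forall>v\<in>pverts G. f v \<in> out_nbrs G v)"
    by (rule hall_marriage) (use fin finite_subset[OF sub fin] hall in auto)
  then obtain f where f: "inj_on f (pverts G)" "\<forall>v\<in>pverts G. f v \<in> out_nbrs G v" by blast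
  then have "f ` pverts G \<subseteq> pverts G" using sub by auto
  then have "bij_betw f (pverts G) (pverts G)"
    using f fin by (simp add: bij_betw_def endo_inj_surj)
  then show False using assms(2) f by (auto simp: admits_SDR_def)
qed

section \<open>Reduction of the infimum to positive vectors\<close>

lemma finite_out_nbrs: "G \<in> graphs_NN n \<Longrightarrow> finite (out_nbrs G v)"
  by (rule finite_subset[of _ "pverts G"]) (auto simp: graphs_NN_iff mem_out_nbrs_iff)

lemma out_nbrs_subset: "G \<in> graphs_NN n \<Longrightarrow> out_nbrs G v \<subseteq> pverts G"
  by (auto simp: graphs_NN_iff mem_out_nbrs_iff)

lemma min_out_le: "G \<in> graphs_NN n \<Longrightarrow> w \<in> out_nbrs G v \<Longrightarrow> min_out G x v \<le> x w"
  unfolding min_out_def by (intro Min_le) (auto simp: finite_out_nbrs)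

lemma le_min_out:
  assumes "G \<in> graphs_NN n" "v \<in> pverts G" "\<And>w. w \<in> out_nbrs G v \<Longrightarrow> c \<le> x w"
  shows "c \<le> min_out G x v"
  unfolding min_out_def using assms finite_out_nbrs[OF assms(1)]
  by (subst Min_ge_iff) (auto simp: graphs_NN_iff)

lemma min_out_pos:
  assumes "G \<in> graphs_NN n" "v \<in> pverts G" "\<And>w. w \<in> pverts G \<Longrightarrow> 0 < x w"
  shows "0 < min_out G x v"
  unfolding min_out_def using assms finite_out_nbrs[OF assms(1)] out_nbrs_subset[OF assms(1)]
  by (subst Min_gr_iff) (auto simp: graphs_NN_iff)

lemma min_sum_pos:
  assumes "G \<in> graphs_NN n" "\<And>w. w \<in> pverts G \<Longrightarrow> 0 < x w"
  shows "min_sum G x = ereal (\<Sum>v\<in>pverts G. x v / min_out G x v)"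
proof -
  have "ereal (x v) / ereal (min_out G x v) = ereal (x v / min_out G x v)" if "v \<in> pverts G" for v
    using min_out_pos[OF assms(1) that, of x] assms(2) by force
  then show ?thesis unfolding min_sum_def by simp
qed

text \<open>Positive in-degree makes \<open>w\<close> an out-neighbour of some \<open>u\<close>. If
  the minimum at \<open>u\<close> were 0, admissibility would force \<open>x u > 0\<close> and the
  term of \<open>u\<close> would be infinite. So this minimum is positive, and it bounds
  \<open>x w\<close> from below.\<close>

lemma min_sum_finite_imp_pos:
  assumes "G \<in> graphs_NN n" "admissible G x" "min_sum G x \<noteq> \<infinity>" "w \<in> pverts G"
  shows "0 < x w"
proof -
  obtain u where u: "w \<in> out_nbrs G u" using assms by (auto simp: graphs_NN_iff)
  then have uV: "u \<in> pverts G" using assms(1) by (auto simp: graphs_NN_iff mem_out_nbrs_iff)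
  have nonneg: "0 \<le> x v" if "v \<in> pverts G" for v
    using assms(2) that by (auto simp: admissible_def)
  have fin: "finite (pverts G)" using assms by (auto simp: graphs_NN_iff)
  have nn: "0 \<le> min_out G x v" if "v \<in> pverts G" for v
    using that assms(1) nonneg out_nbrs_subset[OF assms(1)] by (intro le_min_out) auto
  have "min_out G x u \<noteq> 0"
  proof
    assume 0: "min_out G x u = 0"
    then have "x u > 0" using assms(2) uV nonneg[OF uV] by (force simp: admissible_def)
    then have "ereal (x u) / ereal (min_out G x u) = \<infinity>" using 0 by (simp add: divide_ereal_def)
    moreover have "ereal (x v) / ereal (min_out G x v) \<noteq> -\<infinity>" if "v \<in> pverts G" for v
      using nn[OF that] nonneg[OF that] by (cases "min_out G x v = 0") (auto simp: divide_ereal_def)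
    ultimately have "min_sum G x = \<infinity>"
      unfolding min_sum_def using uV fin by (subst sum_Pinfty) blast
    then show False using assms by simp
  qed
  then have "0 < min_out G x u" using nn[OF uV] by simp
  also have "\<dots> \<le> x w" using min_out_le[OF assms(1) u] .
  finally show ?thesis .
qed

text \<open>Admissible vectors with a zero entry have min-sum \<open>\<infinity>\<close>, so lower
  bounds need checking only for positive vectors, where the sum is real.\<close>

lemma min_sum_inf_geI:
  assumes "G \<in> graphs_NN n"
    and "\<And>x. (\<And>v. v \<in> pverts G \<Longrightarrow> 0 < x v) \<Longrightarrow> c \<le> (\<Sum>v\<in>pverts G. x v / min_out G x v)"
  shows "ereal c \<le> min_sum_inf G"
  unfolding min_sum_inf_def
proof (intro Inf_greatest, clarify)
  fix x assume x: "admissible G x"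
  show "ereal c \<le> min_sum G x"
  proof (cases "min_sum G x = \<infinity>")
    case False
    then have "\<And>v. v \<in> pverts G \<Longrightarrow> 0 < x v" using min_sum_finite_imp_pos[OF assms(1) x] by blast
    then show ?thesis using assms(2) min_sum_pos[OF assms(1)] by simp
  qed simp
qed

lemma min_sum_inf_le:
  assumes "G \<in> graphs_NN n" "0 < n" "\<And>v. v \<in> pverts G \<Longrightarrow> 0 < x v"
  shows "min_sum_inf G \<le> ereal (\<Sum>v\<in>pverts G. x v / min_out G x v)"
proof -
  have "pverts G \<noteq> {}" using assms by (auto simp: graphs_NN_iff)
  then have "admissible G x" using assms(3) by (fastforce simp: admissible_def)
  then show ?thesis
    unfolding min_sum_inf_def using min_sum_pos[OF assms(1,3)] by (force intro: Inf_lower)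
qed

section \<open>Lower bound from an SDR, and the general upper bound\<close>

text \<open>AM-GM through \<open>ln y \<le> y - 1\<close> applied to each ratio: the logarithms
  cancel in the sum because \<open>\<sigma>\<close> permutes \<open>V\<close>.\<close>

lemma sum_ratio_bij_ge_card:
  fixes x :: "'a \<Rightarrow> real"
  assumes "finite V" "bij_betw \<sigma> V V" "\<And>v. v \<in> V \<Longrightarrow> 0 < x v"
  shows "real (card V) \<le> (\<Sum>v\<in>V. x v / x (\<sigma> v))"
proof -
  have \<sigma>: "\<sigma> v \<in> V" if "v \<in> V" for v using assms(2) that by (auto simp: bij_betw_def)
  have "(\<Sum>v\<in>V. 1 + (ln (x v) - ln (x (\<sigma> v)))) \<le> (\<Sum>v\<in>V. x v / x (\<sigma> v))"
  proof (rule sum_mono)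
    fix v assume v: "v \<in> V"
    then show "1 + (ln (x v) - ln (x (\<sigma> v))) \<le> x v / x (\<sigma> v)"
      using ln_le_minus_one[of "x v / x (\<sigma> v)"] assms(3)[OF v] assms(3)[OF \<sigma>[OF v]]
      by (simp add: ln_div)
  qed
  moreover have "(\<Sum>v\<in>V. ln (x (\<sigma> v))) = (\<Sum>v\<in>V. ln (x v))"
    using sum.reindex_bij_betw[OF assms(2)] .
  ultimately show ?thesis by (simp add: sum.distrib sum_subtractf)
qed

lemma SDR_min_sum_inf:
  assumes "G \<in> graphs_NN n" "admits_SDR G"
  shows "ereal (real n) \<le> min_sum_inf G"
proof (rule min_sum_inf_geI[OF assms(1)])
  fix x :: "'a \<Rightarrow> real" assume x: "\<And>v. v \<in> pverts G \<Longrightarrow> 0 < x v"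
  obtain \<sigma> where \<sigma>: "bij_betw \<sigma> (pverts G) (pverts G)" "\<And>v. v \<in> pverts G \<Longrightarrow> \<sigma> v \<in> out_nbrs G v"
    using assms(2) by (auto simp: admits_SDR_def)
  have "finite (pverts G)" "card (pverts G) = n" using assms(1) by (auto simp: graphs_NN_iff)
  then have "real n \<le> (\<Sum>v\<in>pverts G. x v / x (\<sigma> v))"
    using sum_ratio_bij_ge_card[OF _ \<sigma>(1), of x] x by simp
  also have "\<dots> \<le> (\<Sum>v\<in>pverts G. x v / min_out G x v)"
  proof (rule sum_mono)
    fix v assume v: "v \<in> pverts G"
    have "x (\<sigma> v) > 0" using v x \<sigma>(2) out_nbrs_subset[OF assms(1)] by blast
    then show "x v / x (\<sigma> v) \<le> x v / min_out G x v"
      using x[OF v] min_out_le[OF assms(1) \<sigma>(2)[OF v]] min_out_pos[OF assms(1) v, of x] x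
      by (intro divide_left_mono mult_pos_pos) auto
  qed
  finally show "real n \<le> (\<Sum>v\<in>pverts G. x v / min_out G x v)" .
qed

lemma min_sum_inf_le_card:
  assumes "G \<in> graphs_NN n" "0 < n"
  shows "min_sum_inf G \<le> ereal (real n)"
proof -
  have *: "min_out G (\<lambda>_. 1) v = 1" if "v \<in> pverts G" for v
    using assms(1) that by (simp add: min_out_def graphs_NN_iff image_constant_conv)
  show ?thesis using min_sum_inf_le[OF assms, of "\<lambda>_. 1"] * assms(1) by (simp add: graphs_NN_iff)
qed

section \<open>Upper bounds without an SDR\<close>

text \<open>The bound is kept for every \<open>t \<ge> 1\<close>, since its two uses choose
  \<open>t\<close> differently. The factor \<open>(n - 1) div 2\<close> is the largest possible
  value of \<open>card (B - A)\<close>.\<close>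

lemma min_sum_inf_no_SDR:
  fixes t :: real
  assumes G: "G \<in> graphs_NN n" and "0 < n" "\<not> admits_SDR G" and t: "1 \<le> t"
  shows "min_sum_inf G \<le> ereal (real n - (1 - 1/t) + real ((n - 1) div 2) * (t - 1) * (1 - 1/t))"
proof -
  obtain A where A: "A \<subseteq> pverts G" "card (\<Union>(out_nbrs G ` A)) < card A"
    using no_SDR_violator assms by metis
  define B where "B = \<Union>(out_nbrs G ` A)"
  define x where "x v = (if v \<in> B then t else 1)" for v
  have V: "finite (pverts G)" "card (pverts G) = n" using G by (auto simp: graphs_NN_iff)
  have B: "B \<subseteq> pverts G" "card B < card A" using out_nbrs_subset[OF G] A by (auto simp: B_def)
  have fin: "finite A" "finite B" using A B V finite_subset by blast+
  have xpos: "\<And>v. 0 < x v" using t by (auto simp: x_def)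
  have le: "x v / min_out G x v \<le> 1 - (1 - 1/t) * of_bool (v \<in> A - B) + (t - 1) * of_bool (v \<in> B - A)"
    if v: "v \<in> pverts G" for v
  proof -
    \<comment> \<open>Nodes of \<open>A\<close> have all their out-neighbours in \<open>B\<close>,
      where \<open>x\<close> is \<open>t\<close>. The resulting ratio is \<open>1/t\<close> on
      \<open>A - B\<close>, \<open>t\<close> on \<open>B - A\<close>, and 1 elsewhere.\<close>
    have "x v / min_out G x v \<le> x v / (if v \<in> A then t else 1)"
    proof (intro divide_left_mono mult_pos_pos)
      show "(if v \<in> A then t else 1) \<le> min_out G x v"
        using v t by (intro le_min_out[OF G]) (auto simp: x_def B_def)
      show "0 < min_out G x v" using v xpos by (intro min_out_pos[OF G])
    qed (use t xpos in \<open>auto intro: less_imp_le\<close>)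
    also have "\<dots> = 1 - (1 - 1/t) * of_bool (v \<in> A - B) + (t - 1) * of_bool (v \<in> B - A)"
      using t by (auto simp: x_def)
    finally show ?thesis .
  qed
  define q r where "q = card (A - B)" and "r = card (B - A)"
  have "card A = card (A \<inter> B) + q" "card B = card (A \<inter> B) + r"
    using card_Int_Diff[OF fin(1), of B] card_Int_Diff[OF fin(2), of A]
    by (auto simp: q_def r_def Int_commute)
  then have qr: "r < q" using B by simp
  have "q + r = card ((A - B) \<union> (B - A))"
    unfolding q_def r_def using fin by (subst card_Un_disjoint) auto
  also have "\<dots> \<le> n" using A B V card_mono by (metis (no_types, lifting) Diff_subset le_sup_iff order_trans)
  \<comment> \<open>From \<open>q + r \<le> n\<close> and \<open>r < q\<close> follows
    \<open>2 * r + 1 \<le> n\<close>.\<close>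
  finally have r: "r \<le> (n - 1) div 2" using qr by linarith
  have "min_sum_inf G \<le> ereal (\<Sum>v\<in>pverts G. x v / min_out G x v)"
    using min_sum_inf_le[OF G \<open>0 < n\<close> xpos] .
  also have "(\<Sum>v\<in>pverts G. x v / min_out G x v) \<le>
      (\<Sum>v\<in>pverts G. 1 - (1 - 1/t) * of_bool (v \<in> A - B) + (t - 1) * of_bool (v \<in> B - A))"
    using le by (rule sum_mono)
  also have "\<dots> = real n - (1 - 1/t) * real q + (t - 1) * real r"
  proof -
    have "pverts G \<inter> {v. v \<in> A \<and> v \<notin> B} = A - B" "pverts G \<inter> {v. v \<in> B \<and> v \<notin> A} = B - A"
      using A B by auto
    then show ?thesis
      using V by (simp add: sum.distrib sum_subtractf flip: sum_distrib_left) (simp add: q_def r_def)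
  qed
  also have "\<dots> \<le> real n - (1 - 1/t) * (real r + 1) + (t - 1) * real r"
    using qr t by (intro add_right_mono diff_left_mono mult_left_mono) auto
  \<comment> \<open>Since \<open>(t - 1) - (1 - 1/t) = (t - 1) * (1 - 1/t) \<ge> 0\<close>, the
    bound grows with \<open>r\<close>, and \<open>r\<close> may be replaced by its maximum.\<close>
  also have "\<dots> = real n - (1 - 1/t) + real r * ((t - 1) * (1 - 1/t))"
    using t by (simp add: field_simps)
  also have "\<dots> \<le> real n - (1 - 1/t) + real ((n - 1) div 2) * ((t - 1) * (1 - 1/t))"
    using r t by (intro add_left_mono mult_right_mono) auto
  finally show ?thesis by (simp add: mult.assoc)
qed

text \<open>For \<open>t\<close> slightly above 1 the gain \<open>1 - 1/t\<close> is of first order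
  in \<open>t - 1\<close>, while the loss \<open>K * (t - 1) * (1 - 1/t)\<close> is of second order.
  The choice of \<open>t\<close> makes \<open>K * (t - 1) < 1\<close> and also works for
  \<open>K = 0\<close>.\<close>

lemma min_sum_inf_no_SDR_less:
  assumes "G \<in> graphs_NN n" "0 < n" "\<not> admits_SDR G"
  shows "min_sum_inf G < ereal (real n)"
proof -
  define K where "K = real ((n - 1) div 2)"
  define t where "t = 1 + 1 / (K + 1)"
  have K: "0 \<le> K" by (simp add: K_def)
  then have t: "1 < t" by (simp add: t_def)
  have "K * (t - 1) < 1" using K by (simp add: t_def)
  then have "K * (t - 1) * (1 - 1/t) < 1 * (1 - 1/t)"
    using t by (intro mult_strict_right_mono) auto
  then have "real n - (1 - 1/t) + K * (t - 1) * (1 - 1/t) < real n" by simp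
  then show ?thesis
    using min_sum_inf_no_SDR[OF assms, of t] t unfolding K_def
    by (meson ereal_less(2) ereal_less_eq le_less_trans less_ereal.simps(1) less_imp_le)
qed

text \<open>As a function of \<open>t\<close> the bound is
  \<open>n - (2 * K + 1) + K * t + (K + 1) / t\<close>. It is smallest when the last two terms
  agree, both being \<open>sqrt (K * (K + 1))\<close>. Here \<open>K + 1\<close> is the
  \<open>k\<close> in \<open>Delta\<close>.\<close>

lemma min_sum_inf_no_SDR_Delta:
  assumes "G \<in> graphs_NN n" "3 \<le> n" "\<not> admits_SDR G"
  shows "min_sum_inf G \<le> ereal (real n - Delta n)"
proof -
  define K where "K = real ((n - 1) div 2)"
  define t where "t = sqrt (K + 1) / sqrt K"
  have "(n + 1) div 2 = (n - 1) div 2 + 1" using assms by presburger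
  then have D: "Delta n = 2 * K + 1 - 2 * (sqrt (K + 1) * sqrt K)"
    by (simp add: Delta_def Let_def K_def real_sqrt_mult)
  have K: "0 < K" using assms by (simp add: K_def)
  then have t: "1 \<le> t" by (simp add: t_def)
  have "K * t = sqrt (K + 1) * sqrt K" "(K + 1) / t = sqrt (K + 1) * sqrt K"
    using K by (simp_all add: t_def field_simps flip: power2_eq_square)
  moreover have "real n - (1 - 1/t) + K * (t - 1) * (1 - 1/t) = real n - (2 * K + 1) + K * t + (K + 1) / t"
    using t by (simp add: field_simps)
  ultimately have "real n - (1 - 1/t) + K * (t - 1) * (1 - 1/t) = real n - Delta n"
    using D by simp
  moreover have "0 < n" using assms by simp
  ultimately show ?thesis
    using min_sum_inf_no_SDR[OF assms(1) _ assms(3) t, folded K_def] by metis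
qed

section \<open>The extremal graph\<close>

text \<open>The interval \<open>{2 * k - 1..<n}\<close> is empty for odd \<open>n\<close> and a
  single node for even \<open>n > 0\<close>, so one formula covers both parities.\<close>

definition extremal_graph :: "nat \<Rightarrow> nat pair_pre_digraph" where
  "extremal_graph n = (let k = (n + 1) div 2 in
     \<lparr>pverts = {..<n},
      parcs = {..<k} \<times> {k..<2 * k - 1} \<union> {k..<2 * k - 1} \<times> {..<k} \<union>
        {2 * k - 1..<n} \<times> {2 * k - 1..<n}\<rparr>)"

context
  fixes n k :: nat
  assumes n: "3 \<le> n" and k: "k = (n + 1) div 2"
begin

lemma parcs_extremal:
  "parcs (extremal_graph n) = {..<k} \<times> {k..<2 * k - 1} \<union> {k..<2 * k - 1} \<times> {..<k} \<union>
     {2 * k - 1..<n} \<times> {2 * k - 1..<n}"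
  by (simp add: extremal_graph_def Let_def k)

lemma out_nbrs_extremal:
  "v \<in> {..<k} \<Longrightarrow> out_nbrs (extremal_graph n) v = {k..<2 * k - 1}"
  "v \<in> {k..<2 * k - 1} \<Longrightarrow> out_nbrs (extremal_graph n) v = {..<k}"
  "v \<in> {2 * k - 1..<n} \<Longrightarrow> out_nbrs (extremal_graph n) v = {2 * k - 1..<n}"
  by (auto simp: mem_out_nbrs_iff parcs_extremal)

lemma pverts_extremal: "pverts (extremal_graph n) = {..<k} \<union> {k..<2 * k - 1} \<union> {2 * k - 1..<n}"
  using n k by (auto simp: extremal_graph_def Let_def)

lemma extremal_graph_NN: "extremal_graph n \<in> graphs_NN n"
proof -
  have "out_nbrs (extremal_graph n) v \<noteq> {} \<and> (\<exists>u. v \<in> out_nbrs (extremal_graph n) u)"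
    if "v \<in> pverts (extremal_graph n)" for v
  proof -
    consider "v \<in> {..<k}" | "v \<in> {k..<2 * k - 1}" | "v \<in> {2 * k - 1..<n}"
      using \<open>v \<in> _\<close> pverts_extremal by blast
    \<comment> \<open>Both parts are nonempty because \<open>3 \<le> n\<close> gives
      \<open>2 \<le> k\<close>.\<close>
    moreover have "k \<in> {k..<2 * k - 1}" "0 \<in> {..<k}" using n k by auto
    ultimately show ?thesis using out_nbrs_extremal by cases (metis empty_iff)+
  qed
  moreover have "parcs (extremal_graph n) \<subseteq> pverts (extremal_graph n) \<times> pverts (extremal_graph n)"
    using n k by (auto simp: extremal_graph_def Let_def)
  ultimately show ?thesis
    unfolding graphs_NN_iff by (simp add: extremal_graph_def Let_def)
qed

text \<open>The \<open>k\<close> nodes of the larger part share only \<open>k - 1\<close>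
  out-neighbours.\<close>

lemma extremal_graph_no_SDR: "\<not> admits_SDR (extremal_graph n)"
proof
  assume "admits_SDR (extremal_graph n)"
  then obtain \<sigma> where \<sigma>: "bij_betw \<sigma> (pverts (extremal_graph n)) (pverts (extremal_graph n))"
      "\<forall>v\<in>pverts (extremal_graph n). \<sigma> v \<in> out_nbrs (extremal_graph n) v"
    by (auto simp: admits_SDR_def)
  then have "inj_on \<sigma> {..<k}" using pverts_extremal by (auto simp: bij_betw_def inj_on_def)
  moreover have "\<sigma> ` {..<k} \<subseteq> {k..<2 * k - 1}"
    using \<sigma>(2) out_nbrs_extremal(1) pverts_extremal by blast
  ultimately have "card {..<k} \<le> card {k..<2 * k - 1}" by (intro card_inj_on_le) auto
  then show False using n k by simp
qed

text \<open>Only the minima \<open>a\<close> and \<open>b\<close> over the two parts matter: each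
  node of one part has the minimum of the other as denominator and at least its own part's minimum
  as numerator. It remains to minimise \<open>k * (a / b) + (k - 1) * (b / a)\<close>.\<close>

lemma min_sum_inf_extremal_ge: "ereal (real n - Delta n) \<le> min_sum_inf (extremal_graph n)"
proof (rule min_sum_inf_geI[OF extremal_graph_NN])
  let ?G = "extremal_graph n"
  fix x :: "nat \<Rightarrow> real" assume x: "\<And>v. v \<in> pverts ?G \<Longrightarrow> 0 < x v"
  let ?A = "{..<k}" and ?B = "{k..<2 * k - 1}" and ?C = "{2 * k - 1..<n}"
  define f where "f v = x v / min_out ?G x v" for v
  define a b where "a = Min (x ` ?A)" and "b = Min (x ` ?B)"
  have "0 \<in> ?A" "k \<in> ?B" using n k by auto
  then have ne: "?A \<noteq> {}" "?B \<noteq> {}" by blast+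
  then have pos: "0 < a" "0 < b" using x pverts_extremal by (auto simp: a_def b_def)
  have "(\<Sum>v\<in>?A. a / b) \<le> (\<Sum>v\<in>?A. f v)"
    using pos by (intro sum_mono) (simp add: f_def min_out_def out_nbrs_extremal a_def b_def divide_right_mono)
  then have A: "real k * (a / b) \<le> sum f ?A" by simp
  have "(\<Sum>v\<in>?B. b / a) \<le> (\<Sum>v\<in>?B. f v)"
    using pos by (intro sum_mono) (simp add: f_def min_out_def out_nbrs_extremal a_def b_def divide_right_mono)
  then have B: "(real k - 1) * (b / a) \<le> sum f ?B" using n k by (simp add: of_nat_diff)
  \<comment> \<open>An isolated loop contributes exactly 1, so this sum is the number of nodes
    outside the bipartite part.\<close>
  have C: "sum f ?C = real n - (2 * real k - 1)"
  proof (cases "?C = {}")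
    case False
    then have "?C = {2 * k - 1}" "n = 2 * k" using n k by auto
    moreover from this have "f (2 * k - 1) = 1"
      using x[of "2 * k - 1"] out_nbrs_extremal(3)[of "2 * k - 1"] pverts_extremal
      by (auto simp: f_def min_out_def)
    ultimately show ?thesis by simp
  next
    case True
    then have "n = 2 * k - 1" using n k by auto
    then show ?thesis using True n by (simp add: of_nat_diff)
  qed
  define s where "s = sqrt (real k)"
  define r where "r = sqrt (real k - 1)"
  have k1: "1 \<le> real k" using n k by auto
  \<comment> \<open>Completing the square; equality holds for \<open>b / a = s / r\<close>, the
    ratio \<open>sqrt (k / (k - 1))\<close> that is optimal in the upper bound.\<close>
  have "0 \<le> (s * a - r * b)\<^sup>2 / (a * b)" using pos by simp
  also have "\<dots> = s\<^sup>2 * (a / b) + r\<^sup>2 * (b / a) - 2 * (s * r)"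
    using pos by (simp add: field_simps power2_eq_square)
  finally have "2 * (s * r) \<le> real k * (a / b) + (real k - 1) * (b / a)"
    using k1 by (simp add: s_def r_def)
  moreover have "Delta n = 2 * real k - 1 - 2 * (s * r)"
    unfolding Delta_def Let_def s_def r_def k real_sqrt_mult by simp
  ultimately have "real n - Delta n \<le> sum f ?A + sum f ?B + sum f ?C" using A B C by simp
  also have "\<dots> = sum f (pverts ?G)"
    unfolding pverts_extremal by (subst sum.union_disjoint; (subst sum.union_disjoint)?) auto
  finally show "real n - Delta n \<le> (\<Sum>v\<in>pverts ?G. x v / min_out ?G x v)" by (simp add: f_def)
qed

end

text \<open>The maximum ranges over graphs on natural numbers, which represent all finite graphs up
  to isomorphism, whereas a given type \<open>'a\<close> may have fewer than \<open>n\<close>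
  elements.\<close>

theorem theorem3:
  fixes n :: nat
  assumes "1 \<le> n"
  shows "(\<forall>G \<in> (graphs_NN n :: 'a pair_pre_digraph set).
            min_sum_inf G = ereal (real n) \<longleftrightarrow> admits_SDR G) \<and>
         (3 \<le> n \<longrightarrow>
            (let M = {min_sum_inf G |G :: nat pair_pre_digraph. G \<in> graphs_NN n \<and> \<not> admits_SDR G}
             in ereal (real n - Delta n) \<in> M \<and> (\<forall>m \<in> M. m \<le> ereal (real n - Delta n))))"
proof (intro conjI ballI impI)
  fix G :: "'a pair_pre_digraph" assume G: "G \<in> graphs_NN n"
  have n: "0 < n" using assms by simp
  show "min_sum_inf G = ereal (real n) \<longleftrightarrow> admits_SDR G"
    using SDR_min_sum_inf[OF G] min_sum_inf_le_card[OF G n] min_sum_inf_no_SDR_less[OF G n]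
    by (metis antisym less_irrefl)
next
  assume n: "3 \<le> n"
  let ?H = "extremal_graph n"
  note H = extremal_graph_NN[OF n refl] extremal_graph_no_SDR[OF n refl]
  have "min_sum_inf ?H = ereal (real n - Delta n)"
    using min_sum_inf_extremal_ge[OF n refl] min_sum_inf_no_SDR_Delta[OF H(1) n H(2)]
    by (rule antisym[rotated])
  then show "let M = {min_sum_inf G |G :: nat pair_pre_digraph. G \<in> graphs_NN n \<and> \<not> admits_SDR G}
      in ereal (real n - Delta n) \<in> M \<and> (\<forall>m \<in> M. m \<le> ereal (real n - Delta n))"
    unfolding Let_def using H min_sum_inf_no_SDR_Delta[OF _ n] by (auto intro!: exI[of _ ?H])
qed

end
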